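(* Let $\mathbf{H}$ be a fourth-order harmonic tensor on $\mathbb{R}^3$ (totally symmetric and traceless) which is cubic. Consider the linear equation \[ \operatorname{tr}(\mathbf{H}\times \mathbf{a}) = 0 \] in the unknown second-order symmetric tensor $\mathbf{a}$, where in any direct orthonormal basis \[ (\operatorname{tr}(\mathbf{H}\times\mathbf{a}))_{ijk} = \frac{1}{10}\left(\varepsilon_{ipq}H_{jkpr}+\varepsilon_{jpq}H_{ikpr}+\varepsilon_{kpq}H_{ijpr}\right)a_{qr}. \] Then the set of solutions $\mathbf{a}$ is a three-dimensional vector space. Moreover, the orthotropic tensors among these solutions form a dense open subset of this solution space, and for any orthotropic solution $\mathbf{a}$, every natural basis of $\mathbf{a}$ is a natural basis for $\mathbf{H}$.
   Context: $\mathrm{SO}(3)$ acts on tensors by $(g\star\mathbf{T})_{i_1\dots i_n}=g_{i_1j_1}\cdots g_{i_nj_n}T_{j_1\dots j_n}$. $\varepsilon_{ijk}$ is the Levi-Civita tensor, $\varepsilon_{ijk}=\det(\mathbf{e}_i,\mathbf{e}_j,\mathbf{e}_k)$ in a direct orthonormal basis. The symmetry group of a tensor is the subgroup of $\mathrm{SO}(3)$ fixing it. A fourth-order tensor $\mathbf{H}$ is called cubic if its symmetry group is conjugate in $\mathrm{SO}(3)$ to the octahedral group (the orientation-preserving symmetry group of the cube with vertices $(\pm1,\pm1,\pm1)$). A natural basis for a cubic $\mathbf{H}$ is a direct orthonormal basis $(\mathbf{u}_1,\mathbf{u}_2,\mathbf{u}_3)$ such that the symmetry group of $\mathbf{H}$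 is exactly the group of orientation-preserving symmetries of the cube with vertices $\pm\mathbf{u}_1\pm\mathbf{u}_2\pm\mathbf{u}_3$ (equivalently, the components of $\mathbf{H}$ in that basis are of cubic normal form, all components vanishing except those of type $H_{iiii}$, $H_{iijj}$, $H_{ijij}$, with $H_{1111}=H_{2222}=H_{3333}$ and $H_{1122}=H_{1133}=H_{2233}=H_{1212}=H_{1313}=H_{2323}$). A second-order symmetric tensor is orthotropic if it has three distinct eigenvalues; a natural basis for such a tensor is a direct orthonormal basis of its eigenvectors. *)

theory Defs
  imports "HOL-Analysis.Analysis"
begin

text \<open>Vectors of R^3 are real^3; indices range over the type 3.
  Fourth-order tensors are functions of four indices (components in the
  canonical direct orthonormal basis); second-order tensors are 3x3 matrices.\<close>

type_synonym tensor4 = "3 \<Rightarrow> 3 \<Rightarrow> 3 \<Rightarrow> 3 \<Rightarrow> real"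
type_synonym tensor3 = "3 \<Rightarrow> 3 \<Rightarrow> 3 \<Rightarrow> real"

definition SO3 :: "(real^3^3) set" where
  "SO3 = {g. orthogonal_matrix g \<and> det g = 1}"

definition act4 :: "real^3^3 \<Rightarrow> tensor4 \<Rightarrow> tensor4" where
  "act4 g T = (\<lambda>i1 i2 i3 i4. \<Sum>j1\<in>UNIV. \<Sum>j2\<in>UNIV. \<Sum>j3\<in>UNIV. \<Sum>j4\<in>UNIV.
      g$i1$j1 * g$i2$j2 * g$i3$j3 * g$i4$j4 * T j1 j2 j3 j4)"

definition sym_group4 :: "tensor4 \<Rightarrow> (real^3^3) set" where
  "sym_group4 T = {g \<in> SO3. act4 g T = T}"

text \<open>Levi-Civita: eps i j k = det(e_i, e_j, e_k).\<close>
definition eps :: "3 \<Rightarrow> 3 \<Rightarrow> 3 \<Rightarrow> real" where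
  "eps i j k = det (vector [axis i 1, axis j 1, axis k 1] :: real^3^3)"

definition totally_symmetric4 :: "tensor4 \<Rightarrow> bool" where
  "totally_symmetric4 H \<longleftrightarrow> (\<forall>i j k l.
     H i j k l = H j i k l \<and> H i j k l = H i k j l \<and> H i j k l = H i j l k)"

definition traceless4 :: "tensor4 \<Rightarrow> bool" where
  "traceless4 H \<longleftrightarrow> (\<forall>k l. (\<Sum>i\<in>UNIV. H i i k l) = 0)"

definition harmonic4 :: "tensor4 \<Rightarrow> bool" where
  "harmonic4 H \<longleftrightarrow> totally_symmetric4 H \<and> traceless4 H"

text \<open>Vertices of the cube spanned by a basis u.\<close>
definition cube_vertices :: "(3 \<Rightarrow> real^3) \<Rightarrow> (real^3) set" where
  "cube_vertices u = {v. \<exists>s::3 \<Rightarrow> real. (\<forall>i. s i = 1 \<or> s i = -1) \<and> v = (\<Sum>i\<in>UNIV. s i *\<^sub>R u i)}"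

text \<open>Orientation-preserving symmetry group of the cube with vertices given by u.\<close>
definition cube_rot_group :: "(3 \<Rightarrow> real^3) \<Rightarrow> (real^3^3) set" where
  "cube_rot_group u = {g \<in> SO3. (\<lambda>x. g *v x) ` cube_vertices u = cube_vertices u}"

definition std_basis :: "3 \<Rightarrow> real^3" where
  "std_basis i = axis i 1"

text \<open>Octahedral group: rotations of the cube with vertices (+-1,+-1,+-1).\<close>
definition octahedral :: "(real^3^3) set" where
  "octahedral = cube_rot_group std_basis"

definition cubic4 :: "tensor4 \<Rightarrow> bool" where
  "cubic4 H \<longleftrightarrow> (\<exists>g\<in>SO3. sym_group4 H = (\<lambda>h. g ** h ** transpose g) ` octahedral)"

definition direct_orthonormal_basis :: "(3 \<Rightarrow> real^3) \<Rightarrow> bool" where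
  "direct_orthonormal_basis u \<longleftrightarrow>
     (\<forall>i j. u i \<bullet> u j = (if i = j then 1 else 0)) \<and>
     det (vector [u 1, u 2, u 3] :: real^3^3) = 1"

definition natural_basis4 :: "tensor4 \<Rightarrow> (3 \<Rightarrow> real^3) \<Rightarrow> bool" where
  "natural_basis4 H u \<longleftrightarrow> direct_orthonormal_basis u \<and> sym_group4 H = cube_rot_group u"

definition is_eigenvalue :: "real^3^3 \<Rightarrow> real \<Rightarrow> bool" where
  "is_eigenvalue a c \<longleftrightarrow> (\<exists>v. v \<noteq> 0 \<and> a *v v = c *\<^sub>R v)"

definition orthotropic2 :: "real^3^3 \<Rightarrow> bool" where
  "orthotropic2 a \<longleftrightarrow> transpose a = a \<and> card {c. is_eigenvalue a c} = 3"

definition natural_basis2 :: "real^3^3 \<Rightarrow> (3 \<Rightarrow> real^3) \<Rightarrow> bool" where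
  "natural_basis2 a u \<longleftrightarrow> direct_orthonormal_basis u \<and>
     (\<forall>i. \<exists>c. a *v u i = c *\<^sub>R u i)"

text \<open>tr(H x a), in the canonical basis.\<close>
definition trHxa :: "tensor4 \<Rightarrow> real^3^3 \<Rightarrow> tensor3" where
  "trHxa H a = (\<lambda>i j k. (1/10) * (\<Sum>p\<in>UNIV. \<Sum>q\<in>UNIV. \<Sum>r\<in>UNIV.
      (eps i p q * H j k p r + eps j p q * H i k p r + eps k p q * H i j p r) * a$q$r))"

end

theory Submission
  imports Defs
begin

(*
  Choose g \<in> SO(3) with sym_group4 H = g O g\<^sup>T, O the octahedral group, and put K = g\<^sup>T \<star> H.
  K is harmonic and invariant under the half-turns about the axes, which kill every component in
  which some index value occurs an odd number of times, and under the cyclic permutation of the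
  axes; with tracelessness this forces K = \<delta> N, N the cubic normal form, and \<delta> \<noteq> 0 because
  O is not all of SO(3).

  The map a \<mapsto> tr(H \<times> a) is SO(3)-equivariant: \<epsilon> is invariant since det g = 1, and each of
  its three terms is a contraction tr(X\<^sup>T Y Z\<^sup>T) of a slice of \<epsilon>, a slice of H and a, which is
  invariant under simultaneous conjugation.  So the solutions are the g b g\<^sup>T with
  tr(\<delta> N \<times> b) = 0, i.e. with b diagonal.  They form the 3-dimensional space of the
  g diag(d) g\<^sup>T, which are orthotropic iff the d\<^sub>i are distinct, an open dense condition; the
  unit eigenvectors are then the columns of g up to sign and order, and the cube they span has
  rotation group g O g\<^sup>T.
*)

section \<open>Rotations\<close>

lemma SO3_orthogonal: "g \<in> SO3 \<Longrightarrow> orthogonal_matrix g"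
  by (simp add: SO3_def)

lemma SO3_transpose: "g \<in> SO3 \<Longrightarrow> transpose g \<in> SO3"
  by (simp add: SO3_def)

lemma SO3_mult: "g \<in> SO3 \<Longrightarrow> h \<in> SO3 \<Longrightarrow> g ** h \<in> SO3"
  by (simp add: SO3_def orthogonal_matrix_mul det_mul)

lemma SO3_transpose_mult: "g \<in> SO3 \<Longrightarrow> transpose g ** g = mat 1"
  by (simp add: SO3_def orthogonal_matrix_def)

lemma SO3_mult_transpose: "g \<in> SO3 \<Longrightarrow> g ** transpose g = mat 1"
  by (simp add: SO3_def orthogonal_matrix_def)

lemma SO3_conj_cancel: "g \<in> SO3 \<Longrightarrow> transpose g ** (g ** x ** transpose g) ** g = x"
  by (simp add: matrix_mul_assoc SO3_transpose_mult)
    (simp add: matrix_mul_assoc[symmetric] SO3_transpose_mult)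

lemma SO3_mult_vec_cancel: "g \<in> SO3 \<Longrightarrow> transpose g *v (g *v x) = x"
  by (simp add: matrix_vector_mul_assoc SO3_transpose_mult)

lemma SO3_conj_image_iff:
  assumes g: "g \<in> SO3"
  shows "h \<in> (\<lambda>q. g ** q ** transpose g) ` R \<longleftrightarrow> transpose g ** h ** g \<in> R"
  using SO3_conj_cancel[OF g] SO3_conj_cancel[OF SO3_transpose[OF g]]
  by (metis (no_types, lifting) image_iff transpose_transpose)

lemma matrix_add_rdistrib: "(A + B) ** C = A ** C + B ** C"
  for A B :: "'a::semiring_1^'n^'m"
  by (simp add: matrix_matrix_mult_def vec_eq_iff sum.distrib distrib_right)

lemma orthogonal_matrix_columns:
  fixes g :: "real^'n^'n"
  assumes "orthogonal_matrix g"
  shows "(\<Sum>p\<in>UNIV. g$p$a * g$p$b) = (if a = b then 1 else 0)"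
proof -
  have "(transpose g ** g)$a$b = (mat 1 :: real^'n^'n)$a$b"
    using assms by (simp add: orthogonal_matrix_def)
  then show ?thesis by (simp add: matrix_matrix_mult_def transpose_def mat_def)
qed

lemma sum_rotate3:
  "(\<Sum>a\<in>A. \<Sum>b\<in>B. \<Sum>c\<in>C. f a b c) = (\<Sum>b\<in>B. \<Sum>c\<in>C. \<Sum>a\<in>A. f a b c)"
  by (subst sum.swap) (rule sum.cong[OF refl sum.swap])

lemma orthogonal_matrix_contract_bilinear:
  fixes g :: "real^'n^'n"
  assumes "orthogonal_matrix g"
  shows "(\<Sum>p\<in>UNIV. \<Sum>a\<in>UNIV. \<Sum>b\<in>UNIV. g$p$a * g$p$b * F a b) = (\<Sum>a\<in>UNIV. F a a)"
proof -
  have "(\<Sum>p\<in>UNIV. \<Sum>a\<in>UNIV. \<Sum>b\<in>UNIV. g$p$a * g$p$b * F a b)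
      = (\<Sum>a\<in>UNIV. \<Sum>b\<in>UNIV. (\<Sum>p\<in>UNIV. g$p$a * g$p$b) * F a b)"
    unfolding sum_distrib_right by (rule sum_rotate3)
  also have "\<dots> = (\<Sum>a\<in>UNIV. F a a)"
    by (simp add: orthogonal_matrix_columns[OF assms] if_distrib[where f="\<lambda>z. z * _"] cong: if_cong)
  finally show ?thesis .
qed

lemma orthogonal_matrix_inner:
  fixes g :: "real^'n^'n"
  assumes "orthogonal_matrix g"
  shows "(g *v x) \<bullet> (g *v y) = x \<bullet> y"
proof -
  have "orthogonal_transformation ((*v) g)"
    using assms by (simp add: orthogonal_transformation_matrix)
  then show ?thesis by (simp add: orthogonal_transformation_def)
qed

section \<open>The action of rotations on tensors\<close>

definition act3 :: "real^3^3 \<Rightarrow> tensor3 \<Rightarrow> tensor3" where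
  "act3 g T = (\<lambda>i1 i2 i3. \<Sum>j1\<in>UNIV. \<Sum>j2\<in>UNIV. \<Sum>j3\<in>UNIV.
      g$i1$j1 * g$i2$j2 * g$i3$j3 * T j1 j2 j3)"

lemma act3_zero [simp]: "act3 g (\<lambda>i j k. 0) = (\<lambda>i j k. 0)"
  by (simp add: act3_def)

lemma eps_values:
  "eps 1 1 1 = 0" "eps 1 1 2 = 0" "eps 1 1 3 = 0" "eps 1 2 1 = 0" "eps 1 2 2 = 0" "eps 1 2 3 = 1"
  "eps 1 3 1 = 0" "eps 1 3 2 = -1" "eps 1 3 3 = 0"
  "eps 2 1 1 = 0" "eps 2 1 2 = 0" "eps 2 1 3 = -1" "eps 2 2 1 = 0" "eps 2 2 2 = 0" "eps 2 2 3 = 0"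
  "eps 2 3 1 = 1" "eps 2 3 2 = 0" "eps 2 3 3 = 0"
  "eps 3 1 1 = 0" "eps 3 1 2 = 1" "eps 3 1 3 = 0" "eps 3 2 1 = -1" "eps 3 2 2 = 0" "eps 3 2 3 = 0"
  "eps 3 3 1 = 0" "eps 3 3 2 = 0" "eps 3 3 3 = 0"
  by (simp_all add: eps_def det_3 vector_def axis_def)

lemma act3_eps:
  assumes "g \<in> SO3"
  shows "act3 g eps = eps"
proof (intro ext)
  fix i p q
  have rows: "(vector [g$i, g$p, g$q] :: real^3^3) = vector [axis i 1, axis p 1, axis q 1] ** g"
    by (simp add: vec_eq_iff matrix_matrix_mult_def vector_def forall_3 axis_def
        if_distrib[where f="\<lambda>z. z * _"] cong: if_cong)
  have "act3 g eps i p q = det (vector [g$i, g$p, g$q] :: real^3^3)"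
    by (simp add: act3_def sum_3 eps_values det_3 vector_def algebra_simps)
  also have "\<dots> = eps i p q * det g"
    by (simp only: rows det_mul eps_def)
  finally show "act3 g eps i p q = eps i p q"
    using assms by (simp add: SO3_def)
qed

definition act_slot1 :: "real^3^3 \<Rightarrow> tensor4 \<Rightarrow> tensor4" where
  "act_slot1 g T = (\<lambda>a b c d. \<Sum>x\<in>UNIV. g$a$x * T x b c d)"
definition act_slot2 :: "real^3^3 \<Rightarrow> tensor4 \<Rightarrow> tensor4" where
  "act_slot2 g T = (\<lambda>a b c d. \<Sum>x\<in>UNIV. g$b$x * T a x c d)"
definition act_slot3 :: "real^3^3 \<Rightarrow> tensor4 \<Rightarrow> tensor4" where
  "act_slot3 g T = (\<lambda>a b c d. \<Sum>x\<in>UNIV. g$c$x * T a b x d)"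
definition act_slot4 :: "real^3^3 \<Rightarrow> tensor4 \<Rightarrow> tensor4" where
  "act_slot4 g T = (\<lambda>a b c d. \<Sum>x\<in>UNIV. g$d$x * T a b c x)"

lemmas act_slot_defs = act_slot1_def act_slot2_def act_slot3_def act_slot4_def

lemma act4_eq_slots: "act4 g T = act_slot1 g (act_slot2 g (act_slot3 g (act_slot4 g T)))"
  by (simp add: act4_def act_slot_defs sum_distrib_left mult.assoc)

lemma sum_matrix_matrix_mult: "(\<Sum>j\<in>UNIV. g$i$j * (\<Sum>k\<in>UNIV. h$j$k * f k)) = (\<Sum>k\<in>UNIV. (g ** h)$i$k * (f k :: real))"
  for g h :: "real^3^3"
  by (simp add: matrix_matrix_mult_def sum_3 algebra_simps)

lemma act_slot_mult:
  "act_slot1 g (act_slot1 h T) = act_slot1 (g ** h) T" "act_slot2 g (act_slot2 h T) = act_slot2 (g ** h) T"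
  "act_slot3 g (act_slot3 h T) = act_slot3 (g ** h) T" "act_slot4 g (act_slot4 h T) = act_slot4 (g ** h) T"
  by (simp_all add: act_slot_defs sum_matrix_matrix_mult)

lemma act_slot_commute:
  "act_slot1 h (act_slot2 g T) = act_slot2 g (act_slot1 h T)"
  "act_slot1 h (act_slot3 g T) = act_slot3 g (act_slot1 h T)"
  "act_slot1 h (act_slot4 g T) = act_slot4 g (act_slot1 h T)"
  "act_slot2 h (act_slot3 g T) = act_slot3 g (act_slot2 h T)"
  "act_slot2 h (act_slot4 g T) = act_slot4 g (act_slot2 h T)"
  "act_slot3 h (act_slot4 g T) = act_slot4 g (act_slot3 h T)"
  by (simp_all add: act_slot_defs sum_3 algebra_simps)

lemma act_slot_id:
  "act_slot1 (mat 1) T = T" "act_slot2 (mat 1) T = T" "act_slot3 (mat 1) T = T" "act_slot4 (mat 1) T = T"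
  by (simp_all add: act_slot_defs mat_def if_distrib[where f="\<lambda>z. z * _"] cong: if_cong)

lemma act4_mult: "act4 (g ** h) T = act4 g (act4 h T)"
  by (simp only: act4_eq_slots act_slot_commute act_slot_mult)

lemma act4_id: "act4 (mat 1) T = T"
  by (simp only: act4_eq_slots act_slot_id)

lemma act4_zero [simp]: "act4 g (\<lambda>i j k l. 0) = (\<lambda>i j k l. 0)"
  by (simp add: act4_def)

lemma act4_transpose_act4:
  assumes "g \<in> SO3"
  shows "act4 (transpose g) (act4 g T) = T" "act4 g (act4 (transpose g) T) = T"
  by (simp_all add: act4_mult[symmetric] SO3_transpose_mult SO3_mult_transpose assms act4_id)

lemma act4_totally_symmetric:
  assumes "totally_symmetric4 T"
  shows "totally_symmetric4 (act4 g T)"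
proof -
  have s1: "T i j k l = T j i k l" and s2: "T i j k l = T i k j l" and s3: "T i j k l = T i j l k" for i j k l
    using assms unfolding totally_symmetric4_def by blast+
  show ?thesis unfolding totally_symmetric4_def
  proof (intro allI conjI)
    fix i j k l
    show "act4 g T i j k l = act4 g T j i k l" unfolding act4_def
      by (simp add: sum_3 s1[of 2 1] s1[of 3 1] s1[of 3 2] algebra_simps)
    show "act4 g T i j k l = act4 g T i k j l" unfolding act4_def
      by (simp add: sum_3 s2[of _ 2 1] s2[of _ 3 1] s2[of _ 3 2] algebra_simps)
    show "act4 g T i j k l = act4 g T i j l k" unfolding act4_def
      by (simp add: sum_3 s3[of _ _ 2 1] s3[of _ _ 3 1] s3[of _ _ 3 2] algebra_simps)
  qed
qed

lemma act4_traceless: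
  assumes "traceless4 T" "orthogonal_matrix g"
  shows "traceless4 (act4 g T)"
  unfolding traceless4_def
proof (intro allI)
  fix k l
  have "(\<Sum>i\<in>UNIV. act4 g T i i k l) = (\<Sum>i\<in>UNIV. \<Sum>a\<in>UNIV. \<Sum>b\<in>UNIV. g$i$a * g$i$b *
      (\<Sum>c\<in>UNIV. \<Sum>d\<in>UNIV. g$k$c * g$l$d * T a b c d))"
    by (simp add: act4_def sum_distrib_left mult.assoc)
  also have "\<dots> = (\<Sum>a\<in>UNIV. \<Sum>c\<in>UNIV. \<Sum>d\<in>UNIV. g$k$c * g$l$d * T a a c d)"
    by (rule orthogonal_matrix_contract_bilinear[OF assms(2)])
  also have "\<dots> = (\<Sum>c\<in>UNIV. \<Sum>d\<in>UNIV. g$k$c * g$l$d * (\<Sum>a\<in>UNIV. T a a c d))"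
    unfolding sum_distrib_left by (rule sum_rotate3)
  also have "\<dots> = 0" using assms(1) by (simp add: traceless4_def)
  finally show "(\<Sum>i\<in>UNIV. act4 g T i i k l) = 0" .
qed

lemma act4_harmonic: "harmonic4 T \<Longrightarrow> orthogonal_matrix g \<Longrightarrow> harmonic4 (act4 g T)"
  by (simp add: harmonic4_def act4_totally_symmetric act4_traceless)

section \<open>Equivariance of tr(H \<times> a)\<close>

definition triple_contract :: "real^'n^'n \<Rightarrow> real^'n^'n \<Rightarrow> real^'n^'n \<Rightarrow> real" where
  "triple_contract X Y Z = (\<Sum>p\<in>UNIV. \<Sum>q\<in>UNIV. \<Sum>r\<in>UNIV. X$p$q * Y$p$r * Z$q$r)"

lemma triple_contract_trace: "triple_contract X Y Z = trace (transpose X ** Y ** transpose Z)"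
proof -
  have "trace (transpose X ** Y ** transpose Z) = (\<Sum>q\<in>UNIV. \<Sum>r\<in>UNIV. \<Sum>p\<in>UNIV. X$p$q * Y$p$r * Z$q$r)"
    by (simp add: trace_def matrix_matrix_mult_def transpose_def sum_distrib_right)
  also have "\<dots> = triple_contract X Y Z"
    unfolding triple_contract_def by (rule sum_rotate3[symmetric])
  finally show ?thesis ..
qed

lemma trace_conj:
  fixes g A :: "real^'n^'n"
  assumes "orthogonal_matrix g"
  shows "trace (g ** A ** transpose g) = trace A"
proof -
  have "trace (g ** A ** transpose g) = trace (transpose g ** (g ** A))"
    by (rule trace_mul_sym)
  also have "\<dots> = trace A"
    using assms by (simp add: matrix_mul_assoc orthogonal_matrix_def)
  finally show ?thesis .
qed

lemma triple_contract_conj: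
  assumes "orthogonal_matrix g"
  shows "triple_contract (g ** X ** transpose g) (g ** Y ** transpose g) (g ** Z ** transpose g)
    = triple_contract X Y Z"
proof -
  have gg: "transpose g ** g = mat 1"
    using assms by (simp add: orthogonal_matrix_def)
  have "transpose (g ** X ** transpose g) ** (g ** Y ** transpose g) ** transpose (g ** Z ** transpose g)
      = g ** (transpose X ** (transpose g ** g) ** Y ** (transpose g ** g) ** transpose Z) ** transpose g"
    by (simp add: matrix_transpose_mul matrix_mul_assoc)
  then show ?thesis
    by (simp add: triple_contract_trace gg trace_conj[OF assms])
qed

lemma linear_triple_contract_left: "linear (\<lambda>X. triple_contract X Y Z)"
  by (rule linearI) (simp_all add: triple_contract_def sum.distrib sum_distrib_left algebra_simps)

lemma linear_triple_contract_middle: "linear (\<lambda>Y. triple_contract X Y Z)"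
  by (rule linearI) (simp_all add: triple_contract_def sum.distrib sum_distrib_left algebra_simps)

lemma triple_contract_sum_left:
  "triple_contract (\<Sum>a\<in>A. c a *\<^sub>R X a) Y Z = (\<Sum>a\<in>A. c a * triple_contract (X a) Y Z)"
  by (simp add: linear_sum[OF linear_triple_contract_left] linear_scale[OF linear_triple_contract_left])

lemma triple_contract_sum_middle:
  "triple_contract X (\<Sum>a\<in>A. c a *\<^sub>R Y a) Z = (\<Sum>a\<in>A. c a * triple_contract X (Y a) Z)"
  by (simp add: linear_sum[OF linear_triple_contract_middle] linear_scale[OF linear_triple_contract_middle])

definition eps_matrix :: "3 \<Rightarrow> real^3^3" where
  "eps_matrix i = (\<chi> p q. eps i p q)"

definition slice4 :: "tensor4 \<Rightarrow> 3 \<Rightarrow> 3 \<Rightarrow> real^3^3" where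
  "slice4 K j k = (\<chi> p r. K j k p r)"

lemma trHxa_triple_contract: "trHxa H a i j k = (1/10) *
    (triple_contract (eps_matrix i) (slice4 H j k) a + triple_contract (eps_matrix j) (slice4 H i k) a
     + triple_contract (eps_matrix k) (slice4 H i j) a)"
  by (simp add: trHxa_def triple_contract_def eps_matrix_def slice4_def sum.distrib algebra_simps)

lemma matrix_conj_entry: "(g ** X ** transpose g)$p$q = (\<Sum>b\<in>UNIV. \<Sum>c\<in>UNIV. g$p$b * g$q$c * X$b$c)"
  for g X :: "real^3^3"
  by (simp add: matrix_matrix_mult_def transpose_def sum_3 algebra_simps)

lemma eps_matrix_rotate:
  assumes "g \<in> SO3"
  shows "eps_matrix i = (\<Sum>a\<in>UNIV. g$i$a *\<^sub>R (g ** eps_matrix a ** transpose g))"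
proof -
  have "eps i p q = act3 g eps i p q" for p q
    using act3_eps[OF assms] by simp
  then show ?thesis
    by (simp add: vec_eq_iff eps_matrix_def matrix_conj_entry act3_def sum_distrib_left mult.assoc)
qed

lemma slice4_act4:
  "slice4 (act4 g K) j k = (\<Sum>b\<in>UNIV. g$j$b *\<^sub>R (\<Sum>c\<in>UNIV. g$k$c *\<^sub>R (g ** slice4 K b c ** transpose g)))"
  by (simp add: vec_eq_iff slice4_def matrix_conj_entry act4_def sum_distrib_left algebra_simps)

lemma triple_contract_act4:
  assumes "g \<in> SO3"
  shows "triple_contract (eps_matrix i) (slice4 (act4 g K) j k) (g ** B ** transpose g)
    = (\<Sum>a\<in>UNIV. \<Sum>b\<in>UNIV. \<Sum>c\<in>UNIV. g$i$a * g$j$b * g$k$c *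
        triple_contract (eps_matrix a) (slice4 K b c) B)"
proof -
  have "triple_contract (eps_matrix i) (slice4 (act4 g K) j k) (g ** B ** transpose g)
      = (\<Sum>b\<in>UNIV. \<Sum>c\<in>UNIV. \<Sum>a\<in>UNIV. g$i$a * g$j$b * g$k$c *
          triple_contract (eps_matrix a) (slice4 K b c) B)"
    by (simp add: eps_matrix_rotate[OF assms, of i] slice4_act4 triple_contract_sum_left
        triple_contract_sum_middle triple_contract_conj[OF SO3_orthogonal[OF assms]]
        sum_distrib_left mult_ac)
  also have "\<dots> = (\<Sum>a\<in>UNIV. \<Sum>b\<in>UNIV. \<Sum>c\<in>UNIV. g$i$a * g$j$b * g$k$c *
        triple_contract (eps_matrix a) (slice4 K b c) B)"
    by (rule sum_rotate3[symmetric])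
  finally show ?thesis .
qed

lemma trHxa_act4:
  assumes "g \<in> SO3"
  shows "trHxa (act4 g K) (g ** B ** transpose g) = act3 g (trHxa K B)"
  by (intro ext) (simp add: trHxa_triple_contract triple_contract_act4[OF assms] act3_def
      sum_3 algebra_simps)

lemma trHxa_act4_eq_0_iff:
  assumes "g \<in> SO3"
  shows "trHxa (act4 g K) (g ** B ** transpose g) = (\<lambda>i j k. 0) \<longleftrightarrow> trHxa K B = (\<lambda>i j k. 0)"
proof
  assume zero: "trHxa (act4 g K) (g ** B ** transpose g) = (\<lambda>i j k. 0)"
  have "trHxa K B = trHxa (act4 (transpose g) (act4 g K)) (transpose g ** (g ** B ** transpose g) ** g)"
    by (simp only: act4_transpose_act4[OF assms] SO3_conj_cancel[OF assms])
  also have "\<dots> = act3 (transpose g) (trHxa (act4 g K) (g ** B ** transpose g))"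
    using trHxa_act4[OF SO3_transpose[OF assms], of "act4 g K" "g ** B ** transpose g"] by simp
  finally show "trHxa K B = (\<lambda>i j k. 0)"
    by (simp add: zero)
qed (simp add: trHxa_act4[OF assms])

section \<open>Cubic harmonic tensors\<close>

definition signed_perm :: "(3 \<Rightarrow> 3) \<Rightarrow> (3 \<Rightarrow> real) \<Rightarrow> real^3^3" where
  "signed_perm \<pi> s = (\<chi> i j. if j = \<pi> i then s i else 0)"

lemma signed_perm_mult_vec: "(signed_perm \<pi> s *v x)$i = s i * x$(\<pi> i)"
  by (simp add: signed_perm_def matrix_vector_mult_def if_distrib[where f="\<lambda>z. z * _"] cong: if_cong)

lemma act4_signed_perm:
  "act4 (signed_perm \<pi> s) K i j k l = s i * s j * s k * s l * K (\<pi> i) (\<pi> j) (\<pi> k) (\<pi> l)"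
  by (simp add: act4_eq_slots act_slot_defs signed_perm_def if_distrib[where f="\<lambda>z. z * _"]
      cong: if_cong)

definition sign_vectors :: "(real^3) set" where
  "sign_vectors = {v. \<forall>i. v$i = 1 \<or> v$i = -1}"

lemma cube_vertices_std_basis: "cube_vertices std_basis = sign_vectors"
proof -
  have sum_eq: "(\<Sum>i\<in>UNIV. s i *\<^sub>R std_basis i) = (\<chi> j. s j)" for s :: "3 \<Rightarrow> real"
    by (simp add: vec_eq_iff std_basis_def axis_def sum_3 forall_3)
  show ?thesis
    unfolding cube_vertices_def sum_eq sign_vectors_def
    by (auto simp: vec_eq_iff)
qed

lemma octahedral_iff: "g \<in> octahedral \<longleftrightarrow> g \<in> SO3 \<and> (\<lambda>x. g *v x) ` sign_vectors = sign_vectors"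
  by (simp add: octahedral_def cube_rot_group_def cube_vertices_std_basis)

lemma sign_mult: "a = 1 \<or> a = -1 \<Longrightarrow> b = 1 \<or> b = -1 \<Longrightarrow> a * b = 1 \<or> a * b = (-1::real)"
  by auto

lemma signed_perm_octahedral:
  assumes "bij \<pi>" and signs: "\<And>i. s i = 1 \<or> s i = -1" and "signed_perm \<pi> s \<in> SO3"
  shows "signed_perm \<pi> s \<in> octahedral"
  unfolding octahedral_iff
proof (intro conjI equalityI subsetI)
  show "signed_perm \<pi> s \<in> SO3" by fact
next
  fix w assume "w \<in> (\<lambda>x. signed_perm \<pi> s *v x) ` sign_vectors"
  then obtain x where x: "\<And>i. x$i = 1 \<or> x$i = -1" and w: "w = signed_perm \<pi> s *v x"
    by (auto simp: sign_vectors_def)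
  show "w \<in> sign_vectors"
    by (simp add: sign_vectors_def w signed_perm_mult_vec sign_mult signs x)
next
  fix w assume w: "w \<in> sign_vectors"
  define v where "v = (\<chi> j. s (inv \<pi> j) * w$(inv \<pi> j))"
  have "s i * s i = 1" for i using signs[of i] by auto
  then have "signed_perm \<pi> s *v v = w"
    by (simp add: vec_eq_iff signed_perm_mult_vec v_def inv_f_f[OF bij_is_inj[OF assms(1)]]
        mult.assoc[symmetric])
  moreover have "v \<in> sign_vectors"
    using w by (simp add: sign_vectors_def v_def sign_mult signs)
  ultimately show "w \<in> (\<lambda>x. signed_perm \<pi> s *v x) ` sign_vectors" by blast
qed

definition cycle3 :: "3 \<Rightarrow> 3" where
  "cycle3 i = (if i = 1 then 2 else if i = 2 then 3 else 1)"

definition flip_sign :: "3 \<Rightarrow> 3 \<Rightarrow> real" where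
  "flip_sign m i = (if i = m then 1 else -1)"

lemma cycle3_octahedral: "signed_perm cycle3 (\<lambda>_. 1) \<in> octahedral"
proof (rule signed_perm_octahedral)
  show "bij cycle3"
    by (rule o_bij[of "cycle3 \<circ> cycle3"]) (simp_all add: fun_eq_iff forall_3 cycle3_def)
  show "signed_perm cycle3 (\<lambda>_. 1) \<in> SO3"
    by (simp add: SO3_def orthogonal_matrix_def det_3 vec_eq_iff forall_3 sum_3 matrix_matrix_mult_def
        transpose_def mat_def signed_perm_def cycle3_def)
qed simp

lemma flip_octahedral: "signed_perm id (flip_sign m) \<in> octahedral"
proof (rule signed_perm_octahedral)
  show "signed_perm id (flip_sign m) \<in> SO3"
    using exhaust_3[of m]
    by (auto simp add: SO3_def orthogonal_matrix_def det_3 vec_eq_iff forall_3 sum_3 matrix_matrix_mult_def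
        transpose_def mat_def signed_perm_def flip_sign_def)
qed (simp_all add: flip_sign_def)

lemma octahedral_ne_SO3: "\<exists>r\<in>SO3. r \<notin> octahedral"
proof
  \<comment> \<open>a rotation about the third axis by an angle with cosine 3/5 moves the vertex (1,1,1) off the cube\<close>
  define r :: "real^3^3" where "r = vector [vector [3/5, -4/5, 0], vector [4/5, 3/5, 0], vector [0, 0, 1]]"
  show "r \<in> SO3"
    by (simp add: r_def SO3_def orthogonal_matrix_def det_3 vec_eq_iff forall_3 sum_3 matrix_matrix_mult_def
        transpose_def mat_def vector_def)
  have "(\<chi> i. 1) \<in> sign_vectors" "r *v (\<chi> i. 1) \<notin> sign_vectors"
    by (simp_all add: sign_vectors_def r_def matrix_vector_mult_def sum_3 forall_3 vector_def)
  then show "r \<notin> octahedral"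
    unfolding octahedral_iff by blast
qed

definition cubic_harmonic :: tensor4 where
  "cubic_harmonic i j k l = (if i = j \<and> j = k \<and> k = l then 1
     else if (i = j \<and> k = l) \<or> (i = k \<and> j = l) \<or> (i = l \<and> j = k) then -1/2 else 0)"

lemma harmonic4_invariant_eq_cubic_harmonic:
  fixes K :: tensor4
  assumes "harmonic4 K"
    and cycle_inv: "act4 (signed_perm cycle3 (\<lambda>_. 1)) K = K"
    and flip_inv: "\<And>m. act4 (signed_perm id (flip_sign m)) K = K"
  shows "K = (\<lambda>i j k l. K 1 1 1 1 * cubic_harmonic i j k l)"
proof -
  have sym: "K i j k l = K j i k l" "K i j k l = K i k j l" "K i j k l = K i j l k" for i j k l
    using assms(1) by (auto simp: harmonic4_def totally_symmetric4_def)
  have cyc: "K i j k l = K (cycle3 i) (cycle3 j) (cycle3 k) (cycle3 l)" for i j k l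
    using cycle_inv act4_signed_perm[of cycle3 "\<lambda>_. 1" K i j k l] by simp
  have odd_vanish: "K i j k l = 0"
    if "flip_sign m i * flip_sign m j * flip_sign m k * flip_sign m l = -1" for m i j k l
    using flip_inv[of m] act4_signed_perm[of id "flip_sign m" K i j k l] that by simp
  have diag: "K 2 2 2 2 = K 1 1 1 1" "K 3 3 3 3 = K 1 1 1 1"
    using cyc[of 1 1 1 1] cyc[of 2 2 2 2] by (simp_all add: cycle3_def)
  have swap_pairs: "K i i j j = K j j i i" for i j
    using sym(2)[of i i j j] sym(1)[of i j i j] sym(3)[of j i i j] sym(2)[of j i j i] by simp
  have cyc_pairs: "K 2 2 3 3 = K 1 1 2 2" "K 3 3 1 1 = K 1 1 2 2"
    using cyc[of 1 1 2 2] cyc[of 2 2 3 3] by (simp_all add: cycle3_def)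
  have "(\<Sum>i\<in>UNIV. K i i 1 1) = 0"
    using assms(1) by (simp add: harmonic4_def traceless4_def)
  then have trace: "K 1 1 2 2 = - K 1 1 1 1 / 2"
    using cyc_pairs swap_pairs[of 2 1] by (simp add: sum_3)
  have pairs: "K i i j j = - K 1 1 1 1 / 2" if "i \<noteq> j" for i j
    using that exhaust_3[of i] exhaust_3[of j] cyc_pairs trace
      swap_pairs[of 2 1] swap_pairs[of 1 3] swap_pairs[of 3 2] by auto
  have pairs': "K i j i j = - K 1 1 1 1 / 2" "K i j j i = - K 1 1 1 1 / 2" if "i \<noteq> j" for i j
    using pairs[OF that] sym(2)[of i j i j] sym(3)[of i j j i] by simp_all
  have "\<forall>i j k l. K i j k l = K 1 1 1 1 * cubic_harmonic i j k l"
    unfolding forall_3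
    by (simp add: cubic_harmonic_def diag pairs pairs' flip_sign_def
        odd_vanish[of 1] odd_vanish[of 2] odd_vanish[of 3])
  then show ?thesis by blast
qed

lemma cubic4_harmonic4_decomposition:
  assumes harm: "harmonic4 H" and g: "g \<in> SO3"
    and sym_H: "sym_group4 H = (\<lambda>h. g ** h ** transpose g) ` octahedral"
  obtains \<delta> where "\<delta> \<noteq> 0" "H = act4 g (\<lambda>i j k l. \<delta> * cubic_harmonic i j k l)"
proof -
  define K where "K = act4 (transpose g) H"
  have H: "H = act4 g K"
    by (simp add: K_def act4_transpose_act4[OF g])
  have invariant: "act4 q K = K" if "q \<in> octahedral" for q
  proof -
    have "act4 (g ** q ** transpose g) H = H"
      using sym_H that by (auto simp: sym_group4_def)
    moreover have "act4 q K = act4 (transpose g) (act4 (g ** q ** transpose g) H)"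
      by (simp add: K_def act4_mult[symmetric] matrix_mul_assoc SO3_transpose_mult[OF g])
    ultimately show ?thesis
      by (simp add: K_def)
  qed
  have K: "K = (\<lambda>i j k l. K 1 1 1 1 * cubic_harmonic i j k l)"
    using harm g invariant[OF cycle3_octahedral] invariant[OF flip_octahedral]
    by (intro harmonic4_invariant_eq_cubic_harmonic) (simp_all add: K_def act4_harmonic SO3_orthogonal SO3_transpose)
  moreover have "K 1 1 1 1 \<noteq> 0"
  proof
    assume "K 1 1 1 1 = 0"
    then have "sym_group4 H = SO3"
      using H K by (simp add: sym_group4_def)
    moreover obtain r where r: "r \<in> SO3" "r \<notin> octahedral"
      using octahedral_ne_SO3 by blast
    ultimately obtain q where "q \<in> octahedral" "g ** r ** transpose g = g ** q ** transpose g"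
      using sym_H SO3_mult[OF SO3_mult[OF g r(1)] SO3_transpose[OF g]] by auto
    then show False
      using r(2) SO3_conj_cancel[OF g, of r] SO3_conj_cancel[OF g, of q] by metis
  qed
  ultimately show thesis
    using that H by metis
qed

section \<open>The solution space\<close>

definition diag_matrix :: "real^3 \<Rightarrow> real^3^3" where
  "diag_matrix d = (\<chi> i j. if i = j then d$i else 0)"

lemma transpose_diag_matrix [simp]: "transpose (diag_matrix d) = diag_matrix d"
  by (simp add: diag_matrix_def transpose_def vec_eq_iff)

lemma trHxa_cubic_harmonic_eq_0_iff:
  assumes "\<delta> \<noteq> 0" and "transpose b = b"
  shows "trHxa (\<lambda>i j k l. \<delta> * cubic_harmonic i j k l) b = (\<lambda>i j k. 0) \<longleftrightarrow> b \<in> range diag_matrix"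
proof
  have sym: "b$j$i = b$i$j" for i j
    using arg_cong[OF assms(2), of "\<lambda>m. m$i$j"] by (simp add: transpose_def)
  assume "trHxa (\<lambda>i j k l. \<delta> * cubic_harmonic i j k l) b = (\<lambda>i j k. 0)"
  then have "trHxa (\<lambda>i j k l. \<delta> * cubic_harmonic i j k l) b 1 1 2 = 0"
    "trHxa (\<lambda>i j k l. \<delta> * cubic_harmonic i j k l) b 1 1 3 = 0"
    "trHxa (\<lambda>i j k l. \<delta> * cubic_harmonic i j k l) b 1 2 2 = 0"
    by simp_all
  then have "b$1$3 = 0" "b$1$2 = 0" "b$2$3 = 0"
    using assms(1) by (simp_all add: trHxa_def sum_3 eps_values cubic_harmonic_def
        sym[of 1 2] sym[of 1 3] sym[of 2 3])
  then have "b = diag_matrix (\<chi> i. b$i$i)"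
    using sym[of 1 2] sym[of 1 3] sym[of 2 3] by (simp add: diag_matrix_def vec_eq_iff forall_3)
  then show "b \<in> range diag_matrix" by blast
next
  assume "b \<in> range diag_matrix"
  then obtain d where b: "b = diag_matrix d" by blast
  have "\<forall>i j k. trHxa (\<lambda>i j k l. \<delta> * cubic_harmonic i j k l) b i j k = 0"
    unfolding forall_3 b
    by (simp add: trHxa_def sum_3 eps_values cubic_harmonic_def diag_matrix_def)
  then show "trHxa (\<lambda>i j k l. \<delta> * cubic_harmonic i j k l) b = (\<lambda>i j k. 0)"
    by blast
qed

(* keep transpose g *v v, which this simp rule would turn into v v* g *)
declare transpose_matrix_vector [simp del]

definition rotated_diag :: "real^3^3 \<Rightarrow> real^3 \<Rightarrow> real^3^3" where
  "rotated_diag g d = g ** diag_matrix d ** transpose g"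

lemma trHxa_solutions_cubic_harmonic:
  assumes g: "g \<in> SO3" and "\<delta> \<noteq> 0"
  shows "{a. transpose a = a \<and> trHxa (act4 g (\<lambda>i j k l. \<delta> * cubic_harmonic i j k l)) a = (\<lambda>i j k. 0)}
    = range (rotated_diag g)"
    (is "{a. _ \<and> trHxa ?H a = _} = _")
proof (intro set_eqI iffI)
  fix a assume a: "a \<in> {a. transpose a = a \<and> trHxa ?H a = (\<lambda>i j k. 0)}"
  define b where "b = transpose g ** a ** g"
  have a_eq: "a = g ** b ** transpose g"
    using SO3_conj_cancel[OF SO3_transpose[OF g], of a] by (simp add: b_def)
  have "transpose b = b"
    using a by (simp add: b_def matrix_transpose_mul matrix_mul_assoc)
  moreover have "trHxa (\<lambda>i j k l. \<delta> * cubic_harmonic i j k l) b = (\<lambda>i j k. 0)"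
    using a trHxa_act4_eq_0_iff[OF g] unfolding a_eq by simp
  ultimately obtain d where "b = diag_matrix d"
    using trHxa_cubic_harmonic_eq_0_iff[OF assms(2)] by blast
  then show "a \<in> range (rotated_diag g)"
    unfolding a_eq rotated_diag_def by blast
next
  fix a assume "a \<in> range (rotated_diag g)"
  then obtain d where a: "a = g ** diag_matrix d ** transpose g"
    by (auto simp: rotated_diag_def)
  have "trHxa (\<lambda>i j k l. \<delta> * cubic_harmonic i j k l) (diag_matrix d) = (\<lambda>i j k. 0)"
    using trHxa_cubic_harmonic_eq_0_iff[OF assms(2)] by simp
  then show "a \<in> {a. transpose a = a \<and> trHxa ?H a = (\<lambda>i j k. 0)}"
    using trHxa_act4_eq_0_iff[OF g] by (simp add: a matrix_transpose_mul matrix_mul_assoc)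
qed

lemma linear_rotated_diag: "linear (rotated_diag g)"
proof (rule linearI)
  have "diag_matrix (x + y) = diag_matrix x + diag_matrix y" "diag_matrix (r *\<^sub>R x) = r *\<^sub>R diag_matrix x"
    for x y r by (simp_all add: diag_matrix_def vec_eq_iff)
  then show "rotated_diag g (x + y) = rotated_diag g x + rotated_diag g y"
    "rotated_diag g (r *\<^sub>R x) = r *\<^sub>R rotated_diag g x" for x y r
    by (simp_all add: rotated_diag_def matrix_add_ldistrib matrix_add_rdistrib
        matrix_scalar_ac scalar_matrix_assoc[symmetric])
qed

lemma diag_matrix_mult_vec: "(diag_matrix d *v w)$i = d$i * w$i"
  by (simp add: diag_matrix_def matrix_vector_mult_def if_distrib[where f="\<lambda>z. z * _"] cong: if_cong)

lemma rotated_diag_cancel: "g \<in> SO3 \<Longrightarrow> transpose g ** rotated_diag g d ** g = diag_matrix d"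
  unfolding rotated_diag_def by (rule SO3_conj_cancel)

lemma inj_rotated_diag:
  assumes "g \<in> SO3"
  shows "inj (rotated_diag g)"
proof (rule injI)
  fix x y assume "rotated_diag g x = rotated_diag g y"
  then have "diag_matrix x $ i $ i = diag_matrix y $ i $ i" for i
    by (metis rotated_diag_cancel[OF assms])
  then show "x = y" by (simp add: diag_matrix_def vec_eq_iff)
qed

lemma dim_range_rotated_diag: "g \<in> SO3 \<Longrightarrow> dim (range (rotated_diag g)) = 3"
  using dim_image_eq[OF linear_rotated_diag, of g UNIV] inj_rotated_diag
  by (simp add: inj_on_def inj_def)

lemma rotated_diag_eigenvector_iff:
  assumes "g \<in> SO3"
  shows "rotated_diag g d *v v = c *\<^sub>R v \<longleftrightarrow> (\<forall>i. d$i * (transpose g *v v)$i = c * (transpose g *v v)$i)"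
proof -
  let ?w = "transpose g *v v"
  have "rotated_diag g d *v v = c *\<^sub>R v \<longleftrightarrow> transpose g *v (rotated_diag g d *v v) = transpose g *v (c *\<^sub>R v)"
    by (metis SO3_mult_vec_cancel SO3_transpose assms transpose_transpose)
  also have "\<dots> \<longleftrightarrow> diag_matrix d *v ?w = c *\<^sub>R ?w"
  proof -
    have "transpose g ** rotated_diag g d = diag_matrix d ** transpose g"
      by (simp add: rotated_diag_def matrix_mul_assoc SO3_transpose_mult[OF assms])
    then show ?thesis
      by (simp add: matrix_vector_mul_assoc matrix_vector_mult_scaleR)
  qed
  finally show ?thesis
    by (simp add: vec_eq_iff diag_matrix_mult_vec)
qed

lemma is_eigenvalue_rotated_diag:
  assumes g: "g \<in> SO3"
  shows "is_eigenvalue (rotated_diag g d) c \<longleftrightarrow> c = d$1 \<or> c = d$2 \<or> c = d$3"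
proof
  assume "is_eigenvalue (rotated_diag g d) c"
  then obtain v where "v \<noteq> 0" and eigen: "\<forall>i. d$i * (transpose g *v v)$i = c * (transpose g *v v)$i"
    by (auto simp: is_eigenvalue_def rotated_diag_eigenvector_iff[OF g])
  then have "transpose g *v v \<noteq> 0"
    by (metis SO3_mult_vec_cancel SO3_transpose g matrix_vector_mult_0_right transpose_transpose)
  then obtain k where "(transpose g *v v)$k \<noteq> 0"
    by (auto simp: vec_eq_iff)
  then have "c = d$k"
    using eigen[rule_format, of k] by simp
  then show "c = d$1 \<or> c = d$2 \<or> c = d$3"
    using exhaust_3[of k] by auto
next
  assume "c = d$1 \<or> c = d$2 \<or> c = d$3"
  then obtain k where c: "c = d$k" by blast
  have "g *v axis k 1 \<noteq> 0"
    by (metis SO3_mult_vec_cancel g axis_eq_0_iff matrix_vector_mult_0_right zero_neq_one)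
  moreover have "rotated_diag g d *v (g *v axis k 1) = c *\<^sub>R (g *v axis k 1)"
    by (simp add: rotated_diag_eigenvector_iff[OF g] SO3_mult_vec_cancel[OF g] axis_def c)
  ultimately show "is_eigenvalue (rotated_diag g d) c"
    unfolding is_eigenvalue_def by blast
qed

lemma orthotropic2_rotated_diag:
  assumes g: "g \<in> SO3"
  shows "orthotropic2 (rotated_diag g d) \<longleftrightarrow> d$1 \<noteq> d$2 \<and> d$1 \<noteq> d$3 \<and> d$2 \<noteq> d$3"
proof -
  have "{c. is_eigenvalue (rotated_diag g d) c} = {d$1, d$2, d$3}"
    using is_eigenvalue_rotated_diag[OF g] by auto
  moreover have "transpose (rotated_diag g d) = rotated_diag g d"
    by (simp add: rotated_diag_def matrix_transpose_mul matrix_mul_assoc)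
  ultimately show ?thesis
    unfolding orthotropic2_def by (auto simp: card_insert_if)
qed

lemma openin_orthotropic_rotated_diag:
  assumes g: "g \<in> SO3"
  shows "openin (top_of_set (range (rotated_diag g))) {a \<in> range (rotated_diag g). orthotropic2 a}"
proof -
  define \<phi> where "\<phi> i a = (transpose g ** a ** g)$i$i" for i a
  have "linear (\<phi> i)" for i
    by (rule linearI) (simp_all add: \<phi>_def matrix_add_ldistrib matrix_add_rdistrib
        matrix_scalar_ac scalar_matrix_assoc[symmetric])
  then have cont: "continuous_on UNIV (\<phi> i)" for i
    by (simp add: linear_continuous_on linear_conv_bounded_linear)
  define U where "U = {a. \<phi> 1 a \<noteq> \<phi> 2 a} \<inter> {a. \<phi> 1 a \<noteq> \<phi> 3 a} \<inter> {a. \<phi> 2 a \<noteq> \<phi> 3 a}"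
  have "open U"
    unfolding U_def by (intro open_Int open_Collect_neq cont)
  moreover have "{a \<in> range (rotated_diag g). orthotropic2 a} = range (rotated_diag g) \<inter> U"
    using orthotropic2_rotated_diag[OF g] rotated_diag_cancel[OF g]
    by (auto simp: U_def \<phi>_def diag_matrix_def)
  ultimately show ?thesis
    unfolding openin_open by blast
qed

lemma range_rotated_diag_subset_closure_orthotropic:
  assumes g: "g \<in> SO3"
  shows "range (rotated_diag g) \<subseteq> closure {a \<in> range (rotated_diag g). orthotropic2 a}"
proof
  fix a assume "a \<in> range (rotated_diag g)"
  then obtain d where a: "a = rotated_diag g d" by auto
  define w :: "real^3" where "w = vector [0, 1, 2]"
  show "a \<in> closure {a \<in> range (rotated_diag g). orthotropic2 a}"
    unfolding closure_approachable
  proof (intro allI impI)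
    fix e :: real assume "e > 0"
    define e' where "e' = e / (norm (rotated_diag g w) + 1)"
    have pos: "norm (rotated_diag g w) + 1 > 0"
      by (simp add: add_nonneg_pos)
    then have "e' > 0"
      using \<open>e > 0\<close> by (simp add: e'_def)
    \<comment> \<open>along the direction w, d + t w fails to have distinct entries for at most three values of t\<close>
    have "infinite ({0<..<e'} - {d$1 - d$2, (d$1 - d$3)/2, d$2 - d$3})"
      using \<open>e' > 0\<close> by (intro Diff_infinite_finite) auto
    then obtain t where t: "t \<in> {0<..<e'}" "t \<notin> {d$1 - d$2, (d$1 - d$3)/2, d$2 - d$3}"
      by (metis infinite_imp_nonempty ex_in_conv DiffE)
    have "orthotropic2 (rotated_diag g (d + t *\<^sub>R w))"
      using t by (auto simp: orthotropic2_rotated_diag[OF g] w_def vector_def field_simps)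
    moreover have "dist (rotated_diag g (d + t *\<^sub>R w)) a < e"
    proof -
      have "dist (rotated_diag g (d + t *\<^sub>R w)) a = t * norm (rotated_diag g w)"
        using t by (simp add: a dist_norm linear_add[OF linear_rotated_diag] linear_scale[OF linear_rotated_diag])
      also have "\<dots> < e' * (norm (rotated_diag g w) + 1)"
        using t by (intro mult_strict_mono') auto
      also have "\<dots> = e"
        using pos by (simp add: e'_def)
      finally show ?thesis .
    qed
    ultimately show "\<exists>y\<in>{a \<in> range (rotated_diag g). orthotropic2 a}. dist y a < e"
      by blast
  qed
qed

section \<open>Natural bases\<close>

lemma unit_eigenvector_rotated_diag:
  assumes g: "g \<in> SO3" and distinct: "d$1 \<noteq> d$2" "d$1 \<noteq> d$3" "d$2 \<noteq> d$3"
    and eigen: "rotated_diag g d *v v = c *\<^sub>R v" and unit: "v \<bullet> v = 1"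
  obtains k s where "s = 1 \<or> s = -1" "v = s *\<^sub>R (g *v axis k 1)"
proof -
  define w where "w = transpose g *v v"
  have v: "v = g *v w"
    using SO3_mult_vec_cancel[OF SO3_transpose[OF g]] by (simp add: w_def)
  have unit_w: "w \<bullet> w = 1"
    using unit orthogonal_matrix_inner[OF SO3_orthogonal[OF g]] by (simp add: v)
  then have "w \<noteq> 0"
    by auto
  then obtain k where k: "w$k \<noteq> 0"
    by (auto simp: vec_eq_iff)
  have e: "d$i * w$i = c * w$i" for i
    using eigen by (simp add: rotated_diag_eigenvector_iff[OF g] w_def)
  have "c = d$k"
    using e[of k] k by simp
  then have "w$j = 0" if "j \<noteq> k" for j
    using e[of j] that distinct exhaust_3[of j] exhaust_3[of k] by auto
  then have w: "w = w$k *\<^sub>R axis k 1"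
    by (auto simp: vec_eq_iff axis_def)
  define x where "x = w$k"
  have "x\<^sup>2 = 1"
    using unit_w w by (simp add: x_def[symmetric] inner_axis_axis power2_eq_square)
  then have "x = 1 \<or> x = -1"
    by (simp add: power2_eq_1_iff)
  moreover have "v = x *\<^sub>R (g *v axis k 1)"
    using v w by (simp add: x_def[symmetric] matrix_vector_mult_scaleR)
  ultimately show thesis using that by blast
qed

lemma cube_vertices_signed_reindex:
  assumes \<sigma>: "bij \<sigma>" and signs: "\<And>i. \<epsilon> i = 1 \<or> \<epsilon> i = -1"
  shows "cube_vertices (\<lambda>i. \<epsilon> i *\<^sub>R w (\<sigma> i)) = cube_vertices w"
proof -
  have reindex: "(\<Sum>i\<in>UNIV. f (\<sigma> i)) = (\<Sum>k\<in>UNIV. f k)" for f :: "3 \<Rightarrow> real^3"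
    using sum.reindex_bij_betw[OF \<sigma>] .
  show ?thesis
  proof (intro equalityI subsetI)
    fix v assume "v \<in> cube_vertices (\<lambda>i. \<epsilon> i *\<^sub>R w (\<sigma> i))"
    then obtain s where s: "\<And>i. s i = 1 \<or> s i = -1"
      and v: "v = (\<Sum>i\<in>UNIV. s i *\<^sub>R \<epsilon> i *\<^sub>R w (\<sigma> i))"
      by (auto simp: cube_vertices_def)
    define t where "t k = s (inv \<sigma> k) * \<epsilon> (inv \<sigma> k)" for k
    have "v = (\<Sum>i\<in>UNIV. t (\<sigma> i) *\<^sub>R w (\<sigma> i))"
      by (simp add: v t_def inv_f_f[OF bij_is_inj[OF \<sigma>]])
    also have "\<dots> = (\<Sum>k\<in>UNIV. t k *\<^sub>R w k)"
      by (rule reindex)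
    moreover have "t k = 1 \<or> t k = -1" for k
      by (simp add: t_def sign_mult s signs)
    ultimately show "v \<in> cube_vertices w"
      unfolding cube_vertices_def by (intro CollectI exI[of _ t]) blast
  next
    fix v assume "v \<in> cube_vertices w"
    then obtain t where t: "\<And>k. t k = 1 \<or> t k = -1" and v: "v = (\<Sum>k\<in>UNIV. t k *\<^sub>R w k)"
      by (auto simp: cube_vertices_def)
    have "\<epsilon> i * \<epsilon> i = 1" for i
      using signs[of i] by auto
    moreover have "v = (\<Sum>i\<in>UNIV. t (\<sigma> i) *\<^sub>R w (\<sigma> i))"
      unfolding v by (rule reindex[symmetric])
    ultimately have "v = (\<Sum>i\<in>UNIV. (t (\<sigma> i) * \<epsilon> i) *\<^sub>R \<epsilon> i *\<^sub>R w (\<sigma> i))"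
      by (simp add: mult.assoc)
    moreover have "t (\<sigma> i) * \<epsilon> i = 1 \<or> t (\<sigma> i) * \<epsilon> i = -1" for i
      by (simp add: sign_mult t signs)
    ultimately show "v \<in> cube_vertices (\<lambda>i. \<epsilon> i *\<^sub>R w (\<sigma> i))"
      unfolding cube_vertices_def by (intro CollectI exI[of _ "\<lambda>i. t (\<sigma> i) * \<epsilon> i"]) blast
  qed
qed

lemma cube_vertices_mult: "cube_vertices (\<lambda>k. g *v w k) = (\<lambda>x. g *v x) ` cube_vertices w"
proof -
  have "(\<Sum>i\<in>UNIV. s i *\<^sub>R (g *v w i)) = g *v (\<Sum>i\<in>UNIV. s i *\<^sub>R w i)" for s
    by (simp add: linear_sum[OF matrix_vector_mul_linear] matrix_vector_mult_scaleR)
  then show ?thesis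
    unfolding cube_vertices_def by (auto simp: image_Collect)
qed

lemma cube_rot_group_mult:
  assumes g: "g \<in> SO3"
  shows "cube_rot_group (\<lambda>k. g *v w k) = (\<lambda>q. g ** q ** transpose g) ` cube_rot_group w"
proof -
  have inj: "inj ((*v) (transpose g))"
    by (metis SO3_mult_vec_cancel[OF SO3_transpose[OF g]] injI transpose_transpose)
  have "h \<in> SO3 \<longleftrightarrow> transpose g ** h ** g \<in> SO3" for h
    by (metis SO3_conj_cancel[OF SO3_transpose[OF g]] SO3_mult SO3_transpose g transpose_transpose)
  moreover have "(*v) h ` ((*v) g ` C) = (*v) g ` C \<longleftrightarrow> (*v) (transpose g ** h ** g) ` C = C" for h C
  proof -
    have "(*v) h ` ((*v) g ` C) = (*v) g ` C \<longleftrightarrow>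
        (*v) (transpose g) ` ((*v) h ` ((*v) g ` C)) = (*v) (transpose g) ` ((*v) g ` C)"
      by (rule inj_image_eq_iff[OF inj, symmetric])
    moreover have "(*v) (mat 1 :: real^3^3) = (\<lambda>x. x)"
      by (simp add: fun_eq_iff)
    ultimately show ?thesis
      by (simp add: image_image matrix_vector_mul_assoc matrix_mul_assoc SO3_transpose_mult[OF g])
  qed
  ultimately have "h \<in> cube_rot_group (\<lambda>k. g *v w k) \<longleftrightarrow> transpose g ** h ** g \<in> cube_rot_group w" for h
    by (simp add: cube_rot_group_def cube_vertices_mult)
  then show ?thesis
    by (simp add: set_eq_iff SO3_conj_image_iff[OF g])
qed

lemma cube_rot_group_natural_basis2:
  assumes g: "g \<in> SO3" and orth: "orthotropic2 (rotated_diag g d)"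
    and nb: "natural_basis2 (rotated_diag g d) u"
  shows "cube_rot_group u = (\<lambda>q. g ** q ** transpose g) ` octahedral"
proof -
  have distinct: "d$1 \<noteq> d$2" "d$1 \<noteq> d$3" "d$2 \<noteq> d$3"
    using orth orthotropic2_rotated_diag[OF g] by auto
  have orthonormal: "u i \<bullet> u j = (if i = j then 1 else 0)" for i j
    using nb by (simp add: natural_basis2_def direct_orthonormal_basis_def)
  have "\<exists>k s. (s = 1 \<or> s = -1) \<and> u i = s *\<^sub>R (g *v axis k 1)" for i
  proof -
    obtain c where "rotated_diag g d *v u i = c *\<^sub>R u i"
      using nb by (auto simp: natural_basis2_def)
    then show ?thesis
      using unit_eigenvector_rotated_diag[OF g distinct] orthonormal[of i i] by (metis (full_types))
  qed
  then obtain \<sigma> \<epsilon> where signs: "\<And>i. \<epsilon> i = 1 \<or> \<epsilon> i = -1"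
    and u: "\<And>i. u i = \<epsilon> i *\<^sub>R (g *v axis (\<sigma> i) 1)"
    by metis
  have unit: "(g *v axis k 1) \<bullet> (g *v axis k 1) = 1" for k
    by (simp add: orthogonal_matrix_inner[OF SO3_orthogonal[OF g]] inner_axis_axis)
  have "inj \<sigma>"
  proof (rule injI, rule ccontr)
    fix i j assume "\<sigma> i = \<sigma> j" "i \<noteq> j"
    then have "\<epsilon> i * \<epsilon> j = 0"
      using orthonormal[of i j] by (auto simp: u unit)
    then show False
      using signs[of i] signs[of j] by auto
  qed
  then have "bij \<sigma>"
    by (simp add: bij_def finite_UNIV_inj_surj)
  then have "cube_vertices u = cube_vertices (\<lambda>k. g *v std_basis k)"
    using cube_vertices_signed_reindex[OF _ signs, where w = "\<lambda>k. g *v std_basis k"]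
    by (simp add: u[abs_def] std_basis_def)
  then show ?thesis
    using cube_rot_group_mult[OF g, of std_basis]
    by (simp add: cube_rot_group_def octahedral_def)
qed

theorem mainTheorem1:
  fixes H :: tensor4
  assumes "harmonic4 H" and "cubic4 H"
  defines "S \<equiv> {a :: real^3^3. transpose a = a \<and> trHxa H a = (\<lambda>i j k. 0)}"
  shows "subspace S \<and> dim S = 3
    \<and> openin (top_of_set S) {a \<in> S. orthotropic2 a}
    \<and> S \<subseteq> closure {a \<in> S. orthotropic2 a}
    \<and> (\<forall>a \<in> S. orthotropic2 a \<longrightarrow> (\<forall>u. natural_basis2 a u \<longrightarrow> natural_basis4 H u))"
proof -
  obtain g where g: "g \<in> SO3" and sym_H: "sym_group4 H = (\<lambda>h. g ** h ** transpose g) ` octahedral"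
    using assms(2) unfolding cubic4_def by blast
  obtain \<delta> where "\<delta> \<noteq> 0" and H: "H = act4 g (\<lambda>i j k l. \<delta> * cubic_harmonic i j k l)"
    using cubic4_harmonic4_decomposition[OF assms(1) g sym_H] .
  have S: "S = range (rotated_diag g)"
    unfolding S_def H by (rule trHxa_solutions_cubic_harmonic[OF g \<open>\<delta> \<noteq> 0\<close>])
  have "natural_basis4 H u" if "a \<in> S" "orthotropic2 a" "natural_basis2 a u" for a u
    using that cube_rot_group_natural_basis2[OF g] sym_H
    by (auto simp: S natural_basis4_def natural_basis2_def)
  moreover have "subspace S"
    unfolding S by (rule linear_subspace_image[OF linear_rotated_diag subspace_UNIV])
  ultimately show ?thesis
    unfolding S using dim_range_rotated_diag openin_orthotropic_rotated_diag
      range_rotated_diag_subset_closure_orthotropic g by blast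
qed

end
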